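(* Let $G=(V,E)$ be a finite connected simple graph with $E\neq\varnothing$, and let $\ell\in\{3,4,5,6\}$. If $\operatorname{girth}(G)\ge\ell$, then $$\kappa_{\max}^{\mathrm{LLY}}(G)\le 4-\ell+\frac{\ell-2}{\operatorname{mad}(G)}.$$ For $\ell=6$ equality always holds.
   Context: Graphs are finite, simple and undirected. $\operatorname{girth}(G)$ is the length of a shortest cycle of $G$, with $\operatorname{girth}(G)=\infty$ if $G$ is a tree. The maximum average degree is $\operatorname{mad}(G):=\max_{\varnothing\ne H\subseteq G}\frac{2|E(H)|}{|V(H)|}$, the maximum being over nonempty subgraphs $H$ of $G$. Lin--Lu--Yau curvature with fixed combinatorial distance: let $G=(V,E)$ be finite and connected with $E\neq\varnothing$, and let $d$ be its combinatorial (shortest-path) distance. A positive edge weight is a function $w:E\to(0,\infty)$; put $d_x^w:=\sum_{z\sim x}w_{xz}$. For $\alpha\in[0,1]$ and $x\in V$ let $\mu_x^{\alpha,w}$ be the probability measure on $V$ with $\mu_x^{\alpha,w}(x)=\alpha$, $\mu_x^{\alpha,w}(z)=(1-\alpha)w_{xz}/d_x^w$ if $z\sim x$, and $\mu_x^{\alpha,w}(z)=0$ otherwise. Let $W_1$ be the $1$-Wasserstein distance with respect to $d$ (independent of $w$). For an edge $e=xy$, put $\kappa_\alpha^w(x,y):=1-W_1(\mu_x^{\alpha,w},\mu_y^{\alpha,w})$ and $$\kappa_{\mathrm{LLY}}^w(e)=\kappa_{\mathrm{LLY}}^w(x,y):=\lim_{\alpha\to1^-}\frac{\kappa_\alpha^w(x,y)}{1-\alpha}.$$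 Put $\kappa_{\mathrm{LLY}}^w(G):=\min_{e\in E}\kappa_{\mathrm{LLY}}^w(e)$ and $\kappa_{\max}^{\mathrm{LLY}}(G):=\sup_{w:E\to(0,\infty)}\kappa_{\mathrm{LLY}}^w(G)$. *)

theory Defs
  imports "HOL-Probability.Probability" "HOL-Library.Extended_Nat"
begin

text \<open>
  A graph is given by its vertex set \<open>V\<close> and its set \<open>E\<close> of edges, an edge being a two-element
  set of vertices.
\<close>

definition finite_simple_graph :: "'a set \<Rightarrow> 'a set set \<Rightarrow> bool" where
  "finite_simple_graph V E \<longleftrightarrow> finite V \<and> (\<forall>e\<in>E. e \<subseteq> V \<and> card e = 2)"

definition neighbors :: "'a set set \<Rightarrow> 'a \<Rightarrow> 'a set" where
  "neighbors E x = {z. {x, z} \<in> E}"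

definition subgraph_of :: "'a set \<Rightarrow> 'a set set \<Rightarrow> 'a set \<Rightarrow> 'a set set \<Rightarrow> bool" where
  "subgraph_of W F V E \<longleftrightarrow> W \<subseteq> V \<and> F \<subseteq> E \<and> (\<forall>e\<in>F. e \<subseteq> W)"

definition mad :: "'a set \<Rightarrow> 'a set set \<Rightarrow> real" where
  "mad V E = Max {2 * real (card F) / real (card W) | W F. subgraph_of W F V E \<and> W \<noteq> {}}"

text \<open>Walks are nonempty vertex lists; the length of a walk is its number of edges.\<close>

definition is_walk :: "'a set \<Rightarrow> 'a set set \<Rightarrow> 'a list \<Rightarrow> bool" where
  "is_walk V E xs \<longleftrightarrow>
     xs \<noteq> [] \<and> set xs \<subseteq> V \<and> (\<forall>i. Suc i < length xs \<longrightarrow> {xs ! i, xs ! Suc i} \<in> E)"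

definition walk_between :: "'a set \<Rightarrow> 'a set set \<Rightarrow> 'a \<Rightarrow> 'a \<Rightarrow> 'a list \<Rightarrow> bool" where
  "walk_between V E x y xs \<longleftrightarrow> is_walk V E xs \<and> hd xs = x \<and> last xs = y"

definition connected_graph :: "'a set \<Rightarrow> 'a set set \<Rightarrow> bool" where
  "connected_graph V E \<longleftrightarrow> V \<noteq> {} \<and> (\<forall>x\<in>V. \<forall>y\<in>V. \<exists>xs. walk_between V E x y xs)"

text \<open>Only meaningful if some walk joins the two vertices.\<close>

definition graph_dist :: "'a set \<Rightarrow> 'a set set \<Rightarrow> 'a \<Rightarrow> 'a \<Rightarrow> nat" where
  "graph_dist V E x y = (LEAST n. \<exists>xs. walk_between V E x y xs \<and> length xs = Suc n)"

text \<open>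
  A cycle is listed without repeating its first vertex, so its length is the length of the list.
\<close>

definition is_cycle :: "'a set \<Rightarrow> 'a set set \<Rightarrow> 'a list \<Rightarrow> bool" where
  "is_cycle V E xs \<longleftrightarrow>
     is_walk V E xs \<and> distinct xs \<and> length xs \<ge> 3 \<and> {last xs, hd xs} \<in> E"

text \<open>In type \<^typ>\<open>enat\<close> the infimum of the empty set is \<open>\<infinity>\<close>.\<close>

definition girth :: "'a set \<Rightarrow> 'a set set \<Rightarrow> enat" where
  "girth V E = (INF xs\<in>{xs. is_cycle V E xs}. enat (length xs))"

definition wasserstein1 :: "('a \<Rightarrow> 'a \<Rightarrow> real) \<Rightarrow> 'a pmf \<Rightarrow> 'a pmf \<Rightarrow> real" where
  "wasserstein1 d \<mu> \<nu> =
     Inf {measure_pmf.expectation \<pi> (\<lambda>(x, y). d x y) | \<pi>. map_pmf fst \<pi> = \<mu> \<and> map_pmf snd \<pi> = \<nu>}"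

definition positive_weight :: "'a set set \<Rightarrow> ('a set \<Rightarrow> real) \<Rightarrow> bool" where
  "positive_weight E w \<longleftrightarrow> (\<forall>e\<in>E. w e > 0)"

definition weighted_degree :: "'a set set \<Rightarrow> ('a set \<Rightarrow> real) \<Rightarrow> 'a \<Rightarrow> real" where
  "weighted_degree E w x = (\<Sum>z\<in>neighbors E x. w {x, z})"

definition lazy_mass :: "'a set set \<Rightarrow> ('a set \<Rightarrow> real) \<Rightarrow> real \<Rightarrow> 'a \<Rightarrow> 'a \<Rightarrow> real" where
  "lazy_mass E w \<alpha> x z =
     (if z = x then \<alpha>
      else if z \<in> neighbors E x then (1 - \<alpha>) * w {x, z} / weighted_degree E w x
      else 0)"

definition lazy_measure :: "'a set set \<Rightarrow> ('a set \<Rightarrow> real) \<Rightarrow> real \<Rightarrow> 'a \<Rightarrow> 'a pmf" where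
  "lazy_measure E w \<alpha> x = embed_pmf (lazy_mass E w \<alpha> x)"

text \<open>
  The function \<^const>\<open>embed_pmf\<close> is unspecified on functions that are not probability mass
  functions; the next lemma shows that this case does not arise here.
\<close>

lemma pmf_lazy_measure:
  assumes G: "finite_simple_graph V E" and w: "positive_weight E w"
    and \<alpha>: "0 \<le> \<alpha>" "\<alpha> \<le> 1" and x: "neighbors E x \<noteq> {}"
  shows "pmf (lazy_measure E w \<alpha> x) z = lazy_mass E w \<alpha> x z"
proof -
  let ?N = "neighbors E x"
  have "?N \<subseteq> V"
    using G unfolding finite_simple_graph_def neighbors_def by blast
  then have fin: "finite ?N"
    using G finite_subset unfolding finite_simple_graph_def by blast
  have xN: "x \<notin> ?N"
    using G unfolding finite_simple_graph_def neighbors_def by force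
  have pos: "w {x, u} > 0" if "u \<in> ?N" for u
    using w that unfolding positive_weight_def neighbors_def by blast
  have deg: "weighted_degree E w x > 0"
    unfolding weighted_degree_def using fin x pos by (intro sum_pos) auto
  have nonneg: "0 \<le> lazy_mass E w \<alpha> x u" for u
    using \<alpha> pos deg by (auto simp: lazy_mass_def less_imp_le)
  have "(\<Sum>u\<in>?N. lazy_mass E w \<alpha> x u)
      = (\<Sum>u\<in>?N. (1 - \<alpha>) * w {x, u} / weighted_degree E w x)"
    using xN by (intro sum.cong) (auto simp: lazy_mass_def)
  also have "\<dots> = (1 - \<alpha>) * weighted_degree E w x / weighted_degree E w x"
    by (simp add: weighted_degree_def sum_distrib_left sum_divide_distrib)
  also have "\<dots> = 1 - \<alpha>"
    using deg by simp
  finally have "(\<Sum>u\<in>insert x ?N. lazy_mass E w \<alpha> x u) = 1"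
    using fin xN by (simp add: lazy_mass_def)
  moreover have "(\<integral>\<^sup>+ u. ennreal (lazy_mass E w \<alpha> x u) \<partial>count_space UNIV)
      = (\<Sum>u\<in>insert x ?N. ennreal (lazy_mass E w \<alpha> x u))"
    using fin by (intro nn_integral_count_space') (auto simp: lazy_mass_def)
  ultimately have "(\<integral>\<^sup>+ u. ennreal (lazy_mass E w \<alpha> x u) \<partial>count_space UNIV) = 1"
    by (simp add: sum_ennreal nonneg del: sum.insert)
  then show ?thesis
    unfolding lazy_measure_def by (intro pmf_embed_pmf nonneg)
qed

definition kappa_alpha ::
    "'a set \<Rightarrow> 'a set set \<Rightarrow> ('a set \<Rightarrow> real) \<Rightarrow> real \<Rightarrow> 'a \<Rightarrow> 'a \<Rightarrow> real" where
  "kappa_alpha V E w \<alpha> x y =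
     1 - wasserstein1 (\<lambda>u v. real (graph_dist V E u v)) (lazy_measure E w \<alpha> x) (lazy_measure E w \<alpha> y)"

definition kappa_LLY :: "'a set \<Rightarrow> 'a set set \<Rightarrow> ('a set \<Rightarrow> real) \<Rightarrow> 'a \<Rightarrow> 'a \<Rightarrow> real" where
  "kappa_LLY V E w x y = Lim (at_left 1) (\<lambda>\<alpha>. kappa_alpha V E w \<alpha> x y / (1 - \<alpha>))"

definition kappa_LLY_graph :: "'a set \<Rightarrow> 'a set set \<Rightarrow> ('a set \<Rightarrow> real) \<Rightarrow> real" where
  "kappa_LLY_graph V E w = Min {kappa_LLY V E w x y | x y. {x, y} \<in> E}"

text \<open>
  Values of a weight outside \<open>E\<close> play no role, so the supremum below is the one over all
  positive functions on \<open>E\<close>.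
\<close>

definition kappa_LLY_max :: "'a set \<Rightarrow> 'a set set \<Rightarrow> real" where
  "kappa_LLY_max V E = (SUP w\<in>{w. positive_weight E w}. kappa_LLY_graph V E w)"

end

theory Submission imports Defs begin

text \<open>
  Let \<open>s(xy) = w_xy / d_x + w_xy / d_y\<close> be the \<^emph>\<open>share\<close> of an edge: the probability that the walk steps
  from \<open>x\<close> to \<open>y\<close>, plus the probability that it steps from \<open>y\<close> to \<open>x\<close>. All curvature bounds below
  depend on the weight only through the shares.

  A function that changes by at most \<open>1\<close> along every edge bounds the transport cost from below.
  If the girth is at least \<open>l\<close>, some such function takes the values \<open>-1/2\<close> and \<open>1/2\<close> at \<open>x\<close> and \<open>y\<close>, the
  value \<open>-(l-3)/2\<close> at the other neighbours of \<open>x\<close>, and \<open>(l-3)/2\<close> at those of \<open>y\<close>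
  (\<open>separating_function_exists\<close>); this gives \<open>\<kappa>(xy) \<le> 4 - l + (l-2)/2 * s(xy)\<close> (\<open>kappa_LLY_le\<close>).
  In a subgraph with vertex set \<open>W\<close> and edge set \<open>F\<close> the shares add up to at most \<open>|W|\<close>, because
  the steps from one vertex have total probability \<open>1\<close> (\<open>sum_edge_share_le_card\<close>). Averaging
  the edge bound over \<open>F\<close> in a densest subgraph, where \<open>|W| / |F| = 2 / mad\<close>, gives the upper bound.

  Conversely \<open>\<kappa>(xy) \<ge> 2 * s(xy) - 2\<close> in every graph (\<open>kappa_LLY_ge\<close>), by transporting through the
  edge \<open>xy\<close>. So for \<open>l = 6\<close> it remains to find, for each \<open>t < 2 / mad\<close>, a weight all of whose shares are
  at least \<open>t\<close> (\<open>weight_with_large_shares\<close>). Put \<open>w_xy = 1 / (c_x + c_y)\<close>, where \<open>c\<close> maximises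
  \<open>\<Sum>x. ln c_x - t * \<Sum>xy. ln (c_x + c_y)\<close> over \<open>0 < c \<le> 1\<close>. The maximum exists because the density bound
  makes the objective tend to \<open>-\<infinity>\<close> when some \<open>c_x\<close> tends to \<open>0\<close>. Since the left derivative in \<open>c_x\<close> is
  nonnegative at a maximum, \<open>t * d_x \<le> 1 / c_x\<close>, and therefore
  \<open>s(xy) \<ge> t * w_xy * (c_x + c_y) = t\<close>.

  The curvature is a limit whose existence has to be shown: \<open>\<kappa>_\<alpha> / (1 - \<alpha>)\<close> increases with \<open>\<alpha>\<close>
  (\<open>kappa_quotient_mono\<close>) and is bounded above.
\<close>

section \<open>Edge shares and the maximum average degree\<close>

definition edge_share :: "'a set set \<Rightarrow> ('a set \<Rightarrow> real) \<Rightarrow> 'a set \<Rightarrow> real" where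
  "edge_share E w e = (\<Sum>x\<in>e. w e / weighted_degree E w x)"

lemma edge_share_edge:
  assumes "x \<noteq> y"
  shows "edge_share E w {x, y} = w {x, y} / weighted_degree E w x + w {y, x} / weighted_degree E w y"
  using assms by (simp add: edge_share_def insert_commute)

lemma finite_graph_edges:
  assumes "finite_simple_graph V E"
  shows "finite V" "finite E"
proof -
  show "finite V" using assms by (simp add: finite_simple_graph_def)
  moreover have "E \<subseteq> Pow V" using assms by (auto simp: finite_simple_graph_def)
  ultimately show "finite E" using finite_subset by blast
qed

lemma graph_edge_props:
  assumes "finite_simple_graph V E" "{x, y} \<in> E"
  shows "x \<in> V" "y \<in> V" "x \<noteq> y"
  using assms by (auto simp: finite_simple_graph_def)

lemma graph_edge_cases:
  assumes "finite_simple_graph V E" "e \<in> E"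
  obtains x y where "e = {x, y}" "x \<noteq> y"
  using assms by (metis card_2_iff finite_simple_graph_def)

lemma finite_neighbors:
  assumes "finite_simple_graph V E"
  shows "finite (neighbors E x)"
proof (rule finite_subset)
  show "neighbors E x \<subseteq> V"
    using assms by (auto simp: neighbors_def finite_simple_graph_def)
  show "finite V" using assms by (rule finite_graph_edges)
qed

lemma weighted_degree_incident:
  assumes "finite_simple_graph V E"
  shows "weighted_degree E w x = (\<Sum>e | e \<in> E \<and> x \<in> e. w e)"
  unfolding weighted_degree_def
proof (rule sum.reindex_bij_betw[symmetric, of "\<lambda>z. {x, z}", THEN sym])
  show "bij_betw (\<lambda>z. {x, z}) (neighbors E x) {e \<in> E. x \<in> e}"
  proof (rule bij_betwI')
    fix z z' show "({x, z} = {x, z'}) = (z = z')" by (auto simp: doubleton_eq_iff)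
  next
    fix z assume "z \<in> neighbors E x"
    then show "{x, z} \<in> {e \<in> E. x \<in> e}" by (auto simp: neighbors_def)
  next
    fix e assume "e \<in> {e \<in> E. x \<in> e}"
    then have e: "e \<in> E" "x \<in> e" by auto
    from graph_edge_cases[OF assms e(1)] obtain a b where "e = {a, b}" by blast
    with e show "\<exists>z\<in>neighbors E x. e = {x, z}"
      by (auto simp: neighbors_def insert_commute)
  qed
qed

lemma weighted_degree_pos:
  assumes G: "finite_simple_graph V E" and w: "positive_weight E w" and e: "e \<in> E" "x \<in> e"
  shows "weighted_degree E w x > 0"
  unfolding weighted_degree_incident[OF G]
  using e w finite_graph_edges(2)[OF G]
  by (intro sum_pos) (auto simp: positive_weight_def)

text \<open>
  Exchange the order of summation: a vertex contributes the probabilities of stepping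
  from it along edges of the subgraph, which total at most \<open>1\<close>.
\<close>

lemma sum_edge_share_le_card:
  assumes G: "finite_simple_graph V E" and w: "positive_weight E w"
    and H: "subgraph_of W F V E"
  shows "(\<Sum>e\<in>F. edge_share E w e) \<le> real (card W)"
proof -
  have F: "F \<subseteq> E" and W: "W \<subseteq> V" and FW: "\<And>e. e \<in> F \<Longrightarrow> e \<subseteq> W"
    using H by (auto simp: subgraph_of_def)
  have finE: "finite E" and finF: "finite F" and finW: "finite W"
    using finite_graph_edges[OF G] F W finite_subset by auto
  have "(\<Sum>e\<in>F. edge_share E w e) = (\<Sum>e\<in>F. \<Sum>x | x \<in> W \<and> x \<in> e. w e / weighted_degree E w x)"
    unfolding edge_share_def using FW by (intro sum.cong) auto
  also have "\<dots> = (\<Sum>x\<in>W. \<Sum>e | e \<in> F \<and> x \<in> e. w e / weighted_degree E w x)"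
    using finF finW by (rule sum.swap_restrict)
  also have "\<dots> \<le> (\<Sum>x\<in>W. 1)"
  proof (rule sum_mono)
    fix x assume "x \<in> W"
    have "(\<Sum>e | e \<in> F \<and> x \<in> e. w e) \<le> weighted_degree E w x"
      unfolding weighted_degree_incident[OF G] using F finE w
      by (intro sum_mono2) (auto simp: positive_weight_def less_imp_le)
    moreover have "weighted_degree E w x \<ge> 0"
      unfolding weighted_degree_incident[OF G] using w
      by (intro sum_nonneg) (auto simp: positive_weight_def less_imp_le)
    ultimately have "(\<Sum>e | e \<in> F \<and> x \<in> e. w e) / weighted_degree E w x \<le> 1"
      by (simp add: divide_le_eq)
    then show "(\<Sum>e | e \<in> F \<and> x \<in> e. w e / weighted_degree E w x) \<le> 1"
      by (simp add: sum_divide_distrib)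
  qed
  finally show ?thesis by simp
qed

lemma finite_subgraph_densities:
  assumes "finite_simple_graph V E"
  shows "finite {2 * real (card F) / real (card W) | W F. subgraph_of W F V E \<and> W \<noteq> {}}"
proof (rule finite_subset)
  show "{2 * real (card F) / real (card W) | W F. subgraph_of W F V E \<and> W \<noteq> {}}
      \<subseteq> (\<lambda>(W, F). 2 * real (card F) / real (card W)) ` (Pow V \<times> Pow E)"
    by (fastforce simp: subgraph_of_def)
  show "finite ((\<lambda>(W, F). 2 * real (card F) / real (card W)) ` (Pow V \<times> Pow E))"
    using finite_graph_edges[OF assms] by auto
qed

lemma mad_ge:
  assumes "finite_simple_graph V E" "subgraph_of W F V E" "W \<noteq> {}"
  shows "2 * real (card F) / real (card W) \<le> mad V E"
  unfolding mad_def using assms by (intro Max_ge finite_subgraph_densities) auto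

lemma mad_pos:
  assumes G: "finite_simple_graph V E" and "E \<noteq> {}"
  shows "mad V E > 0"
proof -
  obtain e where e: "e \<in> E" using assms by auto
  with G have "e \<subseteq> V" "card e = 2" by (auto simp: finite_simple_graph_def)
  then have "2 * real (card {e}) / real (card e) \<le> mad V E"
    using e by (intro mad_ge[OF G]) (auto simp: subgraph_of_def)
  with \<open>card e = 2\<close> show ?thesis by simp
qed

lemma mad_attained:
  assumes G: "finite_simple_graph V E" and "E \<noteq> {}"
  obtains W F where "subgraph_of W F V E" "W \<noteq> {}" "F \<noteq> {}"
    "mad V E = 2 * real (card F) / real (card W)"
proof -
  let ?S = "{2 * real (card F) / real (card W) | W F. subgraph_of W F V E \<and> W \<noteq> {}}"
  obtain e where "e \<in> E" using assms by auto
  with G have "subgraph_of V {} V E" "V \<noteq> {}"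
    by (auto simp: subgraph_of_def finite_simple_graph_def)
  then have "?S \<noteq> {}" by blast
  with finite_subgraph_densities[OF G] have "mad V E \<in> ?S"
    unfolding mad_def by (rule Max_in)
  then obtain W F where WF: "subgraph_of W F V E" "W \<noteq> {}"
    "mad V E = 2 * real (card F) / real (card W)" by blast
  moreover from this mad_pos[OF assms] have "F \<noteq> {}" by auto
  ultimately show ?thesis using that by blast
qed

lemma card_induced_edges_le:
  assumes G: "finite_simple_graph V E" and "S \<subseteq> V"
  shows "real (card {e \<in> E. e \<subseteq> S}) \<le> mad V E / 2 * real (card S)"
proof (cases "S = {}")
  case True
  with G have "{e \<in> E. e \<subseteq> S} = {}" by (force simp: finite_simple_graph_def)
  then show ?thesis using True by (simp only: card.empty)
next
  case False
  have "finite S" using assms finite_graph_edges finite_subset by blast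
  with False have "card S > 0" by auto
  moreover have "2 * real (card {e \<in> E. e \<subseteq> S}) / real (card S) \<le> mad V E"
    using assms False by (intro mad_ge) (auto simp: subgraph_of_def)
  ultimately show ?thesis by (simp add: field_simps)
qed

text \<open>
  Both sides are integrals over the level \<open>s\<close>: the minimum over an edge is the measure of the levels
  at which both of its ends lie in \<open>{b > s}\<close>, and at each level the number of such edges is bounded by
  the density. The induction peels off one level set at a time, subtracting the smallest positive
  value of \<open>b\<close> on the whole support.
\<close>

lemma sum_edge_minima_le:
  assumes G: "finite_simple_graph V E" and b: "\<And>x. x \<in> V \<Longrightarrow> b x \<ge> (0::real)"
  shows "(\<Sum>e\<in>E. Min (b ` e)) \<le> mad V E / 2 * (\<Sum>x\<in>V. b x)"
  using b
proof (induction "card {x \<in> V. b x > 0}" arbitrary: b rule: less_induct)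
  case (less b)
  define S where "S = {x \<in> V. b x > 0}"
  have finV: "finite V" and finE: "finite E" using finite_graph_edges[OF G] by auto
  have b0: "b x = 0" if "x \<in> V" "x \<notin> S" for x
    using less.prems[OF that(1)] that by (auto simp: S_def)
  have eV: "\<exists>u v. e = {u, v} \<and> u \<in> V \<and> v \<in> V" if "e \<in> E" for e
    using graph_edge_cases[OF G that] graph_edge_props[OF G] that by metis
  show ?case
  proof (cases "S = {}")
    case True
    then have "Min (b ` e) = 0" if "e \<in> E" for e
      using eV[OF that] b0 by auto
    moreover have "(\<Sum>x\<in>V. b x) = 0" using True b0 by simp
    ultimately show ?thesis by simp
  next
    case False
    have finS: "finite S" using finV by (simp add: S_def)
    define m where "m = Min (b ` S)"
    have "m \<in> b ` S" unfolding m_def using finS False by (intro Min_in) auto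
    then obtain s where s: "s \<in> S" "m = b s" by auto
    have m_le: "m \<le> b x" if "x \<in> S" for x
      unfolding m_def using that finS by simp
    have m_pos: "m > 0" using s by (simp add: S_def)
    define b' where "b' x = (if x \<in> S then b x - m else b x)" for x
    have b'_nonneg: "b' x \<ge> 0" if "x \<in> V" for x
      using less.prems[OF that] m_le by (auto simp: b'_def)
    have "{x \<in> V. b' x > 0} \<subset> S"
      using s b0 by (auto simp: b'_def S_def)
    then have "card {x \<in> V. b' x > 0} < card S"
      using finS by (rule psubset_card_mono[rotated])
    then have IH: "(\<Sum>e\<in>E. Min (b' ` e)) \<le> mad V E / 2 * (\<Sum>x\<in>V. b' x)"
      using b'_nonneg by (intro less.hyps) (auto simp: S_def)
    have "Min (b ` e) = Min (b' ` e) + (if e \<subseteq> S then m else 0)" if "e \<in> E" for e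
    proof -
      obtain u v where e: "e = {u, v}" "u \<in> V" "v \<in> V" using eV[OF \<open>e \<in> E\<close>] by blast
      then have min: "Min (f ` e) = min (f u) (f v)" for f :: "'a \<Rightarrow> real" by simp
      have "b u \<ge> 0" "b v \<ge> 0" using less.prems e by auto
      then show ?thesis
        unfolding min b'_def using b0[OF e(2)] b0[OF e(3)] m_le[of u] m_le[of v] m_pos e by auto
    qed
    then have "(\<Sum>e\<in>E. Min (b ` e)) = (\<Sum>e\<in>E. Min (b' ` e)) + (\<Sum>e\<in>E. if e \<subseteq> S then m else 0)"
      by (simp add: sum.distrib)
    also have "(\<Sum>e\<in>E. if e \<subseteq> S then m else 0) = m * real (card {e \<in> E. e \<subseteq> S})"
      using finE by (simp add: sum.If_cases Int_def)
    also have "\<dots> \<le> m * (mad V E / 2 * real (card S))"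
      using card_induced_edges_le[OF G, of S] m_pos by (intro mult_left_mono) (auto simp: S_def)
    also have "(\<Sum>e\<in>E. Min (b' ` e)) \<le> mad V E / 2 * (\<Sum>x\<in>V. b' x)" by (rule IH)
    also have "(\<Sum>x\<in>V. b' x) = (\<Sum>x\<in>V. b x - (if x \<in> S then m else 0))"
      by (intro sum.cong) (auto simp: b'_def)
    also have "\<dots> = (\<Sum>x\<in>V. b x) - (\<Sum>x\<in>V. if x \<in> S then m else 0)"
      by (rule sum_subtractf)
    also have "(\<Sum>x\<in>V. if x \<in> S then m else 0) = m * real (card S)"
      using finV by (simp add: sum.If_cases Int_absorb1 S_def Int_def conj_commute)
    finally show ?thesis by (simp add: algebra_simps)
  qed
qed

section \<open>Weights with large edge shares\<close>

text \<open>
  The log-likelihood of a Bradley--Terry model in which each vertex has won once and each edge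
  stands for \<open>t\<close> comparisons. Its critical points are the \<open>c\<close> with
  \<open>t * (\<Sum>z\<sim>x. c x / (c x + c z)) = 1\<close> for all \<open>x\<close>.
\<close>

definition log_potential :: "'a set \<Rightarrow> 'a set set \<Rightarrow> real \<Rightarrow> ('a \<Rightarrow> real) \<Rightarrow> real" where
  "log_potential V E t c = (\<Sum>x\<in>V. ln (c x)) - t * (\<Sum>e\<in>E. ln (\<Sum>x\<in>e. c x))"

text \<open>
  Coercivity: with \<open>b = - ln c\<close> each edge term \<open>- ln (c u + c v)\<close> is at most \<open>min (b u) (b v)\<close>,
  and the minima are controlled by the density. If \<open>t * mad V E < 2\<close>, the factor on the right is
  positive, so the objective is very negative as soon as one coordinate of \<open>c\<close> is close to \<open>0\<close>.
\<close>

lemma log_potential_le: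
  assumes G: "finite_simple_graph V E" and t: "t \<ge> 0"
    and c: "\<And>x. x \<in> V \<Longrightarrow> 0 < c x" "\<And>x. x \<in> V \<Longrightarrow> c x \<le> 1"
  shows "log_potential V E t c \<le> (1 - t * mad V E / 2) * (\<Sum>x\<in>V. ln (c x))"
proof -
  define b where "b x = - ln (c x)" for x
  have "(\<Sum>e\<in>E. Min (b ` e)) \<le> mad V E / 2 * (\<Sum>x\<in>V. b x)"
    using c by (intro sum_edge_minima_le[OF G]) (simp add: b_def)
  moreover have "- (\<Sum>e\<in>E. ln (\<Sum>x\<in>e. c x)) \<le> (\<Sum>e\<in>E. Min (b ` e))"
    unfolding sum_negf[symmetric]
  proof (rule sum_mono)
    fix e assume "e \<in> E"
    with G obtain u v where e: "e = {u, v}" "u \<noteq> v" by (rule graph_edge_cases)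
    then have "u \<in> V" "v \<in> V" using graph_edge_props[OF G] \<open>e \<in> E\<close> by auto
    then have "ln (c u) \<le> ln (c u + c v)" "ln (c v) \<le> ln (c u + c v)"
      using c(1)[of u] c(1)[of v] by auto
    then show "- ln (\<Sum>x\<in>e. c x) \<le> Min (b ` e)"
      using e by (simp add: b_def)
  qed
  ultimately have "- (\<Sum>e\<in>E. ln (\<Sum>x\<in>e. c x)) \<le> mad V E / 2 * (\<Sum>x\<in>V. b x)"
    by linarith
  from mult_left_mono[OF this t] show ?thesis
    by (simp add: log_potential_def b_def sum_negf algebra_simps)
qed

text \<open>
  On the compact box \<open>[\<delta>, 1]\<^sup>V\<close> a maximum exists. For small \<open>\<delta>\<close> it avoids the lower faces, where
  coercivity forces a value below the one at the constant function \<open>1\<close>. It may lie on an upper face,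
  which is harmless because only perturbations that decrease a coordinate are used later.
\<close>

lemma log_potential_maximizer:
  assumes G: "finite_simple_graph V E" and t: "t \<ge> 0" "t * mad V E < 2"
  obtains \<delta> c where "0 < \<delta>" "\<And>x. x \<in> V \<Longrightarrow> \<delta> < c x" "\<And>x. x \<in> V \<Longrightarrow> c x \<le> 1"
    "\<And>c'. (\<And>x. x \<in> V \<Longrightarrow> \<delta> \<le> c' x \<and> c' x \<le> 1) \<Longrightarrow>
       log_potential V E t c' \<le> log_potential V E t c"
proof -
  have finV: "finite V" using G by (rule finite_graph_edges)
  define \<gamma> where "\<gamma> = 1 - t * mad V E / 2"
  have \<gamma>: "\<gamma> > 0" using t by (simp add: \<gamma>_def)
  define one where "one = (\<lambda>x::'a. 1::real)"
  \<comment> \<open>Chosen so that a coordinate equal to \<delta> pushes the objective at least 1 below its value at one.\<close>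
  define \<delta> where "\<delta> = min (1/2) (exp ((log_potential V E t one - 1) / \<gamma>))"
  have \<delta>: "0 < \<delta>" "\<delta> < 1" by (auto simp: \<delta>_def)
  \<comment> \<open>Coordinates outside V are pinned to 1, which makes the box compact in the whole function space.\<close>
  define K where "K = (\<Pi>\<^sub>E x\<in>UNIV. if x \<in> V then {\<delta>..1} else {1::real})"
  have "compactin (product_topology (\<lambda>i::'a. euclidean) UNIV) K"
    unfolding K_def compactin_PiE by (auto simp: compact_space_def)
  then have "compact K"
    by (simp add: euclidean_product_topology)
  have one: "one \<in> K" using \<delta> by (auto simp: K_def one_def)
  have K: "\<delta> \<le> c x \<and> c x \<le> 1" if "c \<in> K" "x \<in> V" for c x
    using that by (auto simp: K_def PiE_iff split: if_splits dest!: spec[of _ x])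
  have edge_pos: "0 < (\<Sum>x\<in>e. c x)" if "c \<in> K" "e \<in> E" for c e
  proof (rule sum_pos)
    show "finite e" "e \<noteq> {}" using graph_edge_cases[OF G that(2)] by auto
    show "0 < c x" if "x \<in> e" for x
      using K[OF \<open>c \<in> K\<close>, of x] \<delta> G that \<open>e \<in> E\<close> by (force simp: finite_simple_graph_def)
  qed
  have coord: "continuous_on K (\<lambda>c. c x)" for x :: 'a
    by (rule continuous_on_subset[OF continuous_on_product_coordinates]) simp
  have "continuous_on K (log_potential V E t)"
    unfolding log_potential_def
  proof (intro continuous_intros coord ballI)
    fix c x assume "c \<in> K" "x \<in> V"
    then show "c x \<noteq> 0" using K \<delta> by force
  next
    fix c e assume "e \<in> E" "c \<in> K"
    then show "(\<Sum>x\<in>e. c x) \<noteq> 0" using edge_pos by force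
  qed
  then obtain c where c: "c \<in> K" "\<And>c'. c' \<in> K \<Longrightarrow> log_potential V E t c' \<le> log_potential V E t c"
    using continuous_attains_sup[OF \<open>compact K\<close>] one by blast
  show ?thesis
  proof (rule that[of \<delta> c])
    show "c x \<le> 1" if "x \<in> V" for x using K[OF c(1) that] by simp
    show "\<delta> < c x" if x: "x \<in> V" for x
    proof (rule ccontr)
      assume "\<not> \<delta> < c x"
      with K[OF c(1) x] have cx: "c x = \<delta>" by simp
      have "(\<Sum>z\<in>V. ln (c z)) \<le> ln (c x)"
        using finV x K[OF c(1)] \<delta>
        by (simp add: sum.remove) (intro sum_nonpos, force)
      also have "ln (c x) \<le> ln (exp ((log_potential V E t one - 1) / \<gamma>))"
        unfolding cx using \<delta>(1) by (subst ln_le_cancel_iff) (auto simp: \<delta>_def)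
      finally have "\<gamma> * (\<Sum>z\<in>V. ln (c z)) \<le> log_potential V E t one - 1"
        using \<gamma> by (simp add: field_simps)
      moreover have "log_potential V E t c \<le> \<gamma> * (\<Sum>z\<in>V. ln (c z))"
        unfolding \<gamma>_def using K[OF c(1)] \<delta>(1)
        by (intro log_potential_le[OF G t(1)]) (auto intro: less_le_trans)
      ultimately show False using c(2)[OF one] by simp
    qed
    show "log_potential V E t c' \<le> log_potential V E t c"
      if "\<And>x. x \<in> V \<Longrightarrow> \<delta> \<le> c' x \<and> c' x \<le> 1" for c'
    proof -
      define c'' where "c'' x = (if x \<in> V then c' x else 1)" for x
      have "c'' \<in> K" using that by (auto simp: K_def c''_def)
      then have "log_potential V E t c'' \<le> log_potential V E t c" by (rule c(2))
      moreover have "(\<Sum>x\<in>e. c'' x) = (\<Sum>x\<in>e. c' x)" if "e \<in> E" for e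
        using G that by (intro sum.cong) (auto simp: c''_def finite_simple_graph_def)
      then have "log_potential V E t c'' = log_potential V E t c'"
        by (simp add: log_potential_def c''_def)
      ultimately show ?thesis by simp
    qed
  qed (use \<delta> in auto)
qed

text \<open>
  The inequality says that decreasing the single coordinate \<open>c x\<close> of the maximiser does
  not increase the objective to first order.
\<close>

lemma balanced_potential_exists:
  assumes G: "finite_simple_graph V E" and t: "t \<ge> 0" "t * mad V E < 2"
  obtains c where "\<And>x. x \<in> V \<Longrightarrow> 0 < c x"
    "\<And>x. x \<in> V \<Longrightarrow> t * (\<Sum>z\<in>neighbors E x. 1 / (c x + c z)) \<le> 1 / c x"
proof -
  have finV: "finite V" and finE: "finite E" using finite_graph_edges[OF G] by auto
  obtain \<delta> c where \<delta>: "0 < \<delta>" and c: "\<And>x. x \<in> V \<Longrightarrow> \<delta> < c x" "\<And>x. x \<in> V \<Longrightarrow> c x \<le> 1"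
    and max: "\<And>c'. (\<And>x. x \<in> V \<Longrightarrow> \<delta> \<le> c' x \<and> c' x \<le> 1) \<Longrightarrow>
       log_potential V E t c' \<le> log_potential V E t c"
    using log_potential_maximizer[OF G t] by blast
  have pos: "c x > 0" if "x \<in> V" for x using c(1)[OF that] \<delta> by simp
  show ?thesis
  proof (rule that[of c])
    fix x assume x: "x \<in> V"
    let ?N = "neighbors E x"
    have N: "z \<in> V" "z \<noteq> x" if "z \<in> ?N" for z
      using that graph_edge_props[OF G, of x z] by (auto simp: neighbors_def)
    have finN: "finite ?N" using G by (rule finite_neighbors)
    let ?D = "1 / c x - t * (\<Sum>z\<in>?N. 1 / (c x + c z))"
    let ?C = "(\<Sum>z\<in>V - {x}. ln (c z)) - t * (\<Sum>e | e \<in> E \<and> x \<notin> e. ln (\<Sum>z\<in>e. c z))"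
    \<comment> \<open>The objective as a function of the coordinate at x alone; ?C collects the constant terms.\<close>
    define g where "g s = ln s - t * (\<Sum>z\<in>?N. ln (s + c z)) + ?C" for s
    have g: "log_potential V E t (c(x := s)) = g s" for s
    proof -
      let ?c = "c(x := s)"
      have "(\<Sum>z\<in>V. ln (?c z)) = ln s + (\<Sum>z\<in>V - {x}. ln (c z))"
        using finV x by (simp add: sum.remove)
      moreover have "(\<Sum>e\<in>E. ln (\<Sum>z\<in>e. ?c z))
          = (\<Sum>e | e \<in> E \<and> x \<in> e. ln (\<Sum>z\<in>e. ?c z)) + (\<Sum>e | e \<in> E \<and> x \<notin> e. ln (\<Sum>z\<in>e. ?c z))"
        by (subst sum.union_disjoint[symmetric]) (use finE in \<open>auto intro!: sum.cong\<close>)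
      moreover have "(\<Sum>e | e \<in> E \<and> x \<in> e. ln (\<Sum>z\<in>e. ?c z)) = (\<Sum>z\<in>?N. ln (s + c z))"
        unfolding weighted_degree_incident[OF G, symmetric] weighted_degree_def
      proof (intro sum.cong refl arg_cong[of _ _ ln])
        fix z assume "z \<in> ?N"
        from N(2)[OF this] show "(\<Sum>u\<in>{x, z}. ?c u) = s + c z" by (simp del: fun_upd_apply) simp
      qed
      moreover have "(\<Sum>e | e \<in> E \<and> x \<notin> e. ln (\<Sum>z\<in>e. ?c z)) = (\<Sum>e | e \<in> E \<and> x \<notin> e. ln (\<Sum>z\<in>e. c z))"
        by (intro sum.cong arg_cong[of _ _ ln]) auto
      ultimately show ?thesis by (simp add: log_potential_def g_def algebra_simps)
    qed
    have D: "(g has_real_derivative ?D) (at (c x))"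
      unfolding g_def using pos x N pos[OF N(1)]
      by (auto intro!: derivative_eq_intros simp: divide_inverse add_pos_pos)
    have "\<not> ?D < 0"
    proof
      assume "?D < 0"
      from DERIV_neg_dec_left[OF D this] obtain d where d: "d > 0"
        "\<And>h. 0 < h \<Longrightarrow> h < d \<Longrightarrow> g (c x) < g (c x - h)" by blast
      define h where "h = min (d / 2) (c x - \<delta>)"
      have h: "0 < h" "h < d" "\<delta> \<le> c x - h" using d(1) c(1)[OF x] by (auto simp: h_def)
      have "g (c x - h) \<le> log_potential V E t c"
        unfolding g[symmetric] using h c by (intro max) (fastforce intro: less_imp_le)
      also have "\<dots> = g (c x)" using g[of "c x"] by simp
      finally show False using d(2)[OF h(1,2)] by simp
    qed
    then show "t * (\<Sum>z\<in>?N. 1 / (c x + c z)) \<le> 1 / c x" by simp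
  qed (rule pos)
qed

text \<open>
  Take \<open>w {x, y} = 1 / (c x + c y)\<close> for a balanced potential \<open>c\<close>. Then \<open>1 / d x \<ge> t * c x\<close> for the weighted
  degrees \<open>d\<close>, and the factors \<open>c x + c y\<close> cancel in the share.
\<close>

lemma weight_with_large_shares:
  assumes G: "finite_simple_graph V E" and t: "t > 0" "t * mad V E < 2"
  obtains w where "positive_weight E w" "\<And>e. e \<in> E \<Longrightarrow> t \<le> edge_share E w e"
proof -
  obtain c where c: "\<And>x. x \<in> V \<Longrightarrow> 0 < c x"
    "\<And>x. x \<in> V \<Longrightarrow> t * (\<Sum>z\<in>neighbors E x. 1 / (c x + c z)) \<le> 1 / c x"
    using balanced_potential_exists[OF G less_imp_le[OF t(1)] t(2)] by blast
  define w where "w e = 1 / (\<Sum>x\<in>e. c x)" for e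
  have w: "positive_weight E w"
    unfolding positive_weight_def w_def
  proof (intro ballI divide_pos_pos sum_pos)
    fix e assume e: "e \<in> E"
    show "finite e" "e \<noteq> {}" using graph_edge_cases[OF G e] by auto
    show "0 < c x" if "x \<in> e" for x using c(1) G e that by (auto simp: finite_simple_graph_def)
  qed simp
  have deg: "t * c x \<le> 1 / weighted_degree E w x" if "e \<in> E" "x \<in> e" for e x
  proof -
    have x: "x \<in> V" using G that by (auto simp: finite_simple_graph_def)
    have "weighted_degree E w x = (\<Sum>z\<in>neighbors E x. 1 / (c x + c z))"
      unfolding weighted_degree_def w_def
      by (intro sum.cong refl) (use graph_edge_props[OF G] in \<open>auto simp: neighbors_def\<close>)
    moreover have "weighted_degree E w x > 0" by (rule weighted_degree_pos[OF G w that])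
    ultimately show ?thesis using c(1)[OF x] c(2)[OF x] by (simp add: field_simps)
  qed
  have "t \<le> edge_share E w e" if e: "e \<in> E" for e
  proof -
    have we: "w e > 0" using w e by (simp add: positive_weight_def)
    then have "(\<Sum>x\<in>e. c x) \<noteq> 0" by (auto simp: w_def)
    then have "t = w e * (\<Sum>x\<in>e. t * c x)"
      by (simp add: w_def sum_distrib_left[symmetric])
    also have "\<dots> \<le> w e * (\<Sum>x\<in>e. 1 / weighted_degree E w x)"
      using we deg[OF e] by (intro mult_left_mono sum_mono) auto
    also have "\<dots> = edge_share E w e"
      by (simp add: edge_share_def sum_distrib_left)
    finally show ?thesis .
  qed
  with w show ?thesis by (rule that)
qed

section \<open>Graph distance and transport costs\<close>

lemma is_walk_Cons:
  "is_walk V E (u # v # vs) \<longleftrightarrow> u \<in> V \<and> {u, v} \<in> E \<and> is_walk V E (v # vs)"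
  unfolding is_walk_def by (auto simp: nth_Cons split: nat.splits)

lemma is_walk_singleton: "is_walk V E [u] \<longleftrightarrow> u \<in> V"
  by (auto simp: is_walk_def)

lemma graph_dist_le:
  assumes "is_walk V E xs" "hd xs = u" "last xs = v" "length xs = Suc n"
  shows "graph_dist V E u v \<le> n"
  unfolding graph_dist_def using assms by (intro Least_le exI[of _ xs]) (simp add: walk_between_def)

lemma walk_increment_le:
  fixes f :: "'a \<Rightarrow> real"
  assumes f: "\<And>u v. {u, v} \<in> E \<Longrightarrow> f v - f u \<le> 1" and "is_walk V E xs"
  shows "f (last xs) - f (hd xs) \<le> real (length xs) - 1"
  using assms(2)
proof (induction xs rule: induct_list012)
  case (3 u v vs)
  then have "f (last (v # vs)) - f v \<le> real (length (v # vs)) - 1" "{u, v} \<in> E"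
    by (auto simp: is_walk_Cons)
  with f[of u v] show ?case by simp
qed (auto simp: is_walk_def)

lemma increment_le_graph_dist:
  fixes f :: "'a \<Rightarrow> real"
  assumes f: "\<And>u v. {u, v} \<in> E \<Longrightarrow> f v - f u \<le> 1"
    and V: "connected_graph V E" "u \<in> V" "v \<in> V"
  shows "f v - f u \<le> real (graph_dist V E u v)"
proof -
  let ?P = "\<lambda>n. \<exists>xs. walk_between V E u v xs \<and> length xs = Suc n"
  obtain xs where xs: "walk_between V E u v xs" using V by (auto simp: connected_graph_def)
  then have "length xs = Suc (length xs - 1)" by (auto simp: walk_between_def is_walk_def)
  with xs have "?P (length xs - 1)" by blast
  then have "?P (graph_dist V E u v)" unfolding graph_dist_def by (rule LeastI)
  then show ?thesis using walk_increment_le[of E f V] f by (fastforce simp: walk_between_def)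
qed

text \<open>
  The easy half of Kantorovich duality.
\<close>

lemma wasserstein1_ge:
  assumes fin: "finite (set_pmf \<mu>)" "finite (set_pmf \<nu>)"
    and f: "\<And>u v. u \<in> set_pmf \<mu> \<Longrightarrow> v \<in> set_pmf \<nu> \<Longrightarrow> f v - f u \<le> d u v"
  shows "measure_pmf.expectation \<nu> f - measure_pmf.expectation \<mu> f \<le> wasserstein1 d \<mu> \<nu>"
  unfolding wasserstein1_def
proof (rule cInf_greatest)
  show "{measure_pmf.expectation \<pi> (\<lambda>(x, y). d x y) |\<pi>. map_pmf fst \<pi> = \<mu> \<and> map_pmf snd \<pi> = \<nu>} \<noteq> {}"
    using map_fst_pair_pmf[of \<mu> \<nu>] map_snd_pair_pmf[of \<mu> \<nu>] by blast
  fix r assume "r \<in> {measure_pmf.expectation \<pi> (\<lambda>(x, y). d x y) |\<pi>.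
    map_pmf fst \<pi> = \<mu> \<and> map_pmf snd \<pi> = \<nu>}"
  then obtain \<pi> where r: "r = measure_pmf.expectation \<pi> (\<lambda>(x, y). d x y)"
    and \<pi>: "map_pmf fst \<pi> = \<mu>" "map_pmf snd \<pi> = \<nu>" by blast
  have sub: "set_pmf \<pi> \<subseteq> set_pmf \<mu> \<times> set_pmf \<nu>"
    unfolding \<pi>[symmetric] by (force simp: set_map_pmf)
  then have fin\<pi>: "finite (set_pmf \<pi>)" using fin finite_subset by blast
  have "measure_pmf.expectation \<nu> f - measure_pmf.expectation \<mu> f
      = measure_pmf.expectation \<pi> (\<lambda>p. f (snd p)) - measure_pmf.expectation \<pi> (\<lambda>p. f (fst p))"
    unfolding \<pi>[symmetric] by simp
  also have "\<dots> = measure_pmf.expectation \<pi> (\<lambda>p. f (snd p) - f (fst p))"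
    using fin\<pi> by (simp add: integrable_measure_pmf_finite)
  also have "\<dots> \<le> r"
    unfolding r using fin\<pi> sub f
    by (intro integral_mono_AE integrable_measure_pmf_finite) (auto simp: AE_measure_pmf_iff)
  finally show "measure_pmf.expectation \<nu> f - measure_pmf.expectation \<mu> f \<le> r" .
qed

lemma wasserstein1_le:
  assumes "\<And>u v. d u v \<ge> 0" "map_pmf fst \<pi> = \<mu>" "map_pmf snd \<pi> = \<nu>"
  shows "wasserstein1 d \<mu> \<nu> \<le> measure_pmf.expectation \<pi> (\<lambda>(x, y). d x y)"
  unfolding wasserstein1_def using assms
  by (intro cInf_lower bdd_belowI[of _ 0]) (auto intro!: Bochner_Integration.integral_nonneg)

text \<open>
  The cost of the independent coupling, when \<open>d u v\<close> is majorised by a difference of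
  potentials except at the single pair \<open>p\<close>. For two lazy measures
  with moving probability \<open>1 - \<alpha>\<close>, a pair in which both points have moved has mass of order
  \<open>(1 - \<alpha>)\<^sup>2\<close>, so an exceptional pair of this kind does not affect
  the limiting curvature.
\<close>

lemma wasserstein1_le_product:
  assumes d: "\<And>u v. d u v \<ge> 0" and fin: "finite (set_pmf \<mu>)" "finite (set_pmf \<nu>)"
    and hg: "\<And>u v. u \<in> set_pmf \<mu> \<Longrightarrow> v \<in> set_pmf \<nu> \<Longrightarrow>
       d u v \<le> g v - h u + k * (if (u, v) = p then 1 else 0)"
  shows "wasserstein1 d \<mu> \<nu> \<le> measure_pmf.expectation \<nu> g - measure_pmf.expectation \<mu> h
    + k * (pmf \<mu> (fst p) * pmf \<nu> (snd p))"
proof -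
  let ?\<pi> = "pair_pmf \<mu> \<nu>"
  have int: "integrable ?\<pi> f" for f :: "'a \<times> 'a \<Rightarrow> real"
    using fin by (intro integrable_measure_pmf_finite) (simp add: set_pair_pmf)
  have "wasserstein1 d \<mu> \<nu> \<le> measure_pmf.expectation ?\<pi> (\<lambda>(u, v). d u v)"
    by (intro wasserstein1_le d map_fst_pair_pmf map_snd_pair_pmf)
  also have "\<dots> \<le> measure_pmf.expectation ?\<pi> (\<lambda>q. g (snd q) - h (fst q) + k * indicator {p} q)"
  proof (intro integral_mono_AE int)
    have "d u v \<le> g v - h u + k * indicator {p} (u, v)" if "(u, v) \<in> set_pmf ?\<pi>" for u v
      using hg[of u v] that by (cases "(u, v) = p") auto
    then show "AE q in ?\<pi>. (case q of (u, v) \<Rightarrow> d u v) \<le> g (snd q) - h (fst q) + k * indicator {p} q"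
      by (auto simp: AE_measure_pmf_iff)
  qed
  also have "\<dots> = measure_pmf.expectation ?\<pi> (\<lambda>q. g (snd q))
      - measure_pmf.expectation ?\<pi> (\<lambda>q. h (fst q)) + k * measure ?\<pi> {p}"
    using int by (simp del: integral_indicator)
  also have "measure_pmf.expectation ?\<pi> (\<lambda>q. g (snd q)) = measure_pmf.expectation \<nu> g"
    using integral_map_pmf[of snd ?\<pi> g] by (simp add: map_snd_pair_pmf)
  also have "measure_pmf.expectation ?\<pi> (\<lambda>q. h (fst q)) = measure_pmf.expectation \<mu> h"
    using integral_map_pmf[of fst ?\<pi> h] by (simp add: map_fst_pair_pmf)
  also have "measure ?\<pi> {p} = pmf \<mu> (fst p) * pmf \<nu> (snd p)"
    by (cases p) (simp add: measure_pmf_single pmf_pair)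
  finally show ?thesis .
qed

lemma expectation_bernoulli_mixture:
  fixes f :: "'b \<Rightarrow> real"
  assumes "finite (set_pmf \<mu>)" "0 \<le> r" "r \<le> 1"
  shows "measure_pmf.expectation (bind_pmf (bernoulli_pmf r) (\<lambda>b. if b then \<mu> else return_pmf x)) f
    = r * measure_pmf.expectation \<mu> f + (1 - r) * f x"
proof -
  let ?A = "insert x (set_pmf \<mu>)"
  let ?m = "bind_pmf (bernoulli_pmf r) (\<lambda>b. if b then \<mu> else return_pmf x)"
  have pmf: "pmf ?m z = r * pmf \<mu> z + (1 - r) * pmf (return_pmf x) z" for z
    using assms by (simp add: pmf_bind)
  have exp: "measure_pmf.expectation p f = (\<Sum>z\<in>?A. pmf p z * f z)"
    if "set_pmf p \<subseteq> ?A" for p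
    using that assms(1) by (subst integral_measure_pmf[of ?A]) auto
  have "set_pmf ?m \<subseteq> ?A" by (auto simp: set_bind_pmf split: if_splits)
  then have "measure_pmf.expectation ?m f
      = r * (\<Sum>z\<in>?A. pmf \<mu> z * f z) + (1 - r) * (\<Sum>z\<in>?A. pmf (return_pmf x) z * f z)"
    unfolding exp[OF \<open>set_pmf ?m \<subseteq> ?A\<close>] pmf
    by (simp only: sum_distrib_left sum.distrib[symmetric]) (simp add: algebra_simps)
  also have "(\<Sum>z\<in>?A. pmf \<mu> z * f z) = measure_pmf.expectation \<mu> f"
    by (rule exp[symmetric]) auto
  also have "(\<Sum>z\<in>?A. pmf (return_pmf x) z * f z) = measure_pmf.expectation (return_pmf x) f"
    by (rule exp[symmetric]) auto
  finally show ?thesis by simp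
qed

text \<open>
  Joint convexity of the transport cost: mix any coupling with the point mass at \<open>(x, y)\<close>.
\<close>

lemma wasserstein1_mixture_le:
  assumes d: "\<And>u v. d u v \<ge> 0" and fin: "finite (set_pmf \<mu>)" "finite (set_pmf \<nu>)"
    and r: "0 < r" "r \<le> 1"
  shows "wasserstein1 d (bind_pmf (bernoulli_pmf r) (\<lambda>b. if b then \<mu> else return_pmf x))
      (bind_pmf (bernoulli_pmf r) (\<lambda>b. if b then \<nu> else return_pmf y))
    \<le> r * wasserstein1 d \<mu> \<nu> + (1 - r) * d x y" (is "?W \<le> _")
proof -
  have "(?W - (1 - r) * d x y) / r \<le> wasserstein1 d \<mu> \<nu>"
    unfolding wasserstein1_def[of d \<mu> \<nu>]
  proof (rule cInf_greatest)
    show "{measure_pmf.expectation \<pi> (\<lambda>(x, y). d x y) |\<pi>. map_pmf fst \<pi> = \<mu> \<and> map_pmf snd \<pi> = \<nu>} \<noteq> {}"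
      using map_fst_pair_pmf[of \<mu> \<nu>] map_snd_pair_pmf[of \<mu> \<nu>] by blast
    fix s assume "s \<in> {measure_pmf.expectation \<pi> (\<lambda>(x, y). d x y) |\<pi>.
      map_pmf fst \<pi> = \<mu> \<and> map_pmf snd \<pi> = \<nu>}"
    then obtain \<pi> where s: "s = measure_pmf.expectation \<pi> (\<lambda>(x, y). d x y)"
      and \<pi>: "map_pmf fst \<pi> = \<mu>" "map_pmf snd \<pi> = \<nu>" by blast
    have "set_pmf \<pi> \<subseteq> set_pmf \<mu> \<times> set_pmf \<nu>"
      unfolding \<pi>[symmetric] by (force simp: set_map_pmf)
    then have fin\<pi>: "finite (set_pmf \<pi>)" using fin finite_subset by blast
    let ?\<pi> = "bind_pmf (bernoulli_pmf r) (\<lambda>b. if b then \<pi> else return_pmf (x, y))"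
    have "?W \<le> measure_pmf.expectation ?\<pi> (\<lambda>(x, y). d x y)"
      unfolding \<pi>[symmetric] by (intro wasserstein1_le d) 
        (auto simp: map_bind_pmf if_distrib[of "map_pmf _"] cong: if_cong)
    also have "\<dots> = r * s + (1 - r) * d x y"
      using expectation_bernoulli_mixture[OF fin\<pi>] r s by simp
    finally show "(?W - (1 - r) * d x y) / r \<le> s" using r by (simp add: field_simps)
  qed
  then show ?thesis using r by (simp add: field_simps)
qed

section \<open>Curvature of an edge\<close>

lemma girth_le_cycle_length:
  assumes "girth V E \<ge> enat l" "is_cycle V E xs"
  shows "l \<le> length xs"
  using assms by (auto simp: girth_def le_INF_iff)

lemma girth_ge_3: "girth V E \<ge> enat 3"
  by (auto simp: girth_def le_INF_iff is_cycle_def)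

text \<open>
  Each exceptional configuration closes up, through the edge \<open>xy\<close>, to a cycle of length
  3, 4 or 5 respectively.
\<close>

lemma no_short_cycle_through_edge:
  assumes G: "finite_simple_graph V E" and g: "girth V E \<ge> enat l" and xy: "{x, y} \<in> E"
    and a: "a \<in> neighbors E x - {y}" and b: "b \<in> neighbors E y - {x}"
  shows "l \<ge> 4 \<Longrightarrow> a \<noteq> b"
    and "l \<ge> 5 \<Longrightarrow> {a, b} \<notin> E"
    and "l \<ge> 6 \<Longrightarrow> {a, z} \<in> E \<Longrightarrow> {b, z} \<in> E \<Longrightarrow> z = x \<or> z = y"
proof -
  note ed = graph_edge_props[OF G]
  have E: "{x, a} \<in> E" "{b, y} \<in> E" "{y, x} \<in> E" "a \<noteq> y" "b \<noteq> x"
    using a b xy by (auto simp: neighbors_def insert_commute)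
  note V = ed[OF xy] ed[OF E(1)] ed[OF E(2)]
  show ne: "a \<noteq> b" if "l \<ge> 4"
  proof
    assume "a = b"
    then have "is_cycle V E [x, a, y]"
      using E V by (auto simp: is_cycle_def is_walk_Cons is_walk_singleton)
    from girth_le_cycle_length[OF g this] that show False by simp
  qed
  show nadj: "{a, b} \<notin> E" if "l \<ge> 5"
  proof
    assume "{a, b} \<in> E"
    then have "is_cycle V E [x, a, b, y]"
      using E V ne that by (auto simp: is_cycle_def is_walk_Cons is_walk_singleton)
    from girth_le_cycle_length[OF g this] that show False by simp
  qed
  show "z = x \<or> z = y" if l: "l \<ge> 6" and z: "{a, z} \<in> E" "{b, z} \<in> E"
  proof (rule ccontr)
    assume "\<not> (z = x \<or> z = y)"
    then have "is_cycle V E [x, a, z, b, y]"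
      using E V ne nadj l z ed[OF z(1)] ed[OF z(2)]
      by (auto simp: is_cycle_def is_walk_Cons is_walk_singleton insert_commute)
    from girth_le_cycle_length[OF g this] l show False by simp
  qed
qed

text \<open>
  The neighbours of \<open>x\<close> other than \<open>y\<close> and the neighbours of \<open>y\<close> other than \<open>x\<close> have distance at least
  \<open>l - 3\<close> in a graph of girth at least \<open>l\<close>, which leaves room for the two prescribed values. The value \<open>0\<close>
  works at every remaining vertex if \<open>l < 6\<close>; for \<open>l = 6\<close> the values at the two neighbourhoods are
  \<open>-3/2\<close> and \<open>3/2\<close>, and the vertices next to them need the intermediate values \<open>-1/2\<close> and \<open>1/2\<close>.
\<close>

lemma separating_function_exists:
  fixes x y :: 'a
  assumes G: "finite_simple_graph V E" and l: "l \<in> {3, 4, 5, 6}" and g: "girth V E \<ge> enat l"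
    and xy: "{x, y} \<in> E"
  obtains f :: "'a \<Rightarrow> real" where "\<And>u v. {u, v} \<in> E \<Longrightarrow> f v - f u \<le> 1"
    "f x = -1/2" "f y = 1/2"
    "\<And>z. z \<in> neighbors E x - {y} \<Longrightarrow> f z = - (real l - 3) / 2"
    "\<And>z. z \<in> neighbors E y - {x} \<Longrightarrow> f z = (real l - 3) / 2"
proof -
  define A where "A = neighbors E x - {y}"
  define B where "B = neighbors E y - {x}"
  define r where "r = (real l - 3) / 2"
  define mid :: "'a \<Rightarrow> real" where "mid z = (if l < 6 then 0
    else if \<exists>a\<in>A. {a, z} \<in> E then -1/2 else if \<exists>b\<in>B. {b, z} \<in> E then 1/2 else 0)" for z
  define f where "f z = (if z = x then -1/2 else if z = y then 1/2
    else if z \<in> A then -r else if z \<in> B then r else mid z)" for z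
  note nc = no_short_cycle_through_edge[OF G g xy, folded A_def B_def]
  have x: "x \<notin> A" "y \<notin> A" "x \<notin> B" "y \<notin> B" "x \<noteq> y"
    using graph_edge_props(3)[OF G, of x x] graph_edge_props(3)[OF G, of y y]
      graph_edge_props(3)[OF G xy] by (auto simp: A_def B_def neighbors_def)
  have xA: "v \<in> A" if "{x, v} \<in> E \<or> {v, x} \<in> E" "v \<noteq> y" for v
    using that by (auto simp: A_def neighbors_def insert_commute)
  have yB: "v \<in> B" if "{y, v} \<in> E \<or> {v, y} \<in> E" "v \<noteq> x" for v
    using that by (auto simp: B_def neighbors_def insert_commute)
  have mid: "\<bar>mid z\<bar> \<le> 1/2" for z by (simp add: mid_def)
  have l_cases: "l = 3 \<and> r = 0 \<or> l = 4 \<and> r = 1/2 \<or> l = 5 \<and> r = 1 \<or> l = 6 \<and> r = 3/2"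
    using l by (auto simp: r_def)
  have half: "\<bar>f z\<bar> \<le> 1/2" if "l \<le> 4 \<or> z \<notin> A \<and> z \<notin> B" for z
    using that mid[of z] l_cases by (auto simp: f_def)
  have above_A: "f v \<le> 1 - r" if uv: "{u, v} \<in> E" and u: "u \<in> A" for u v
  proof (cases "l \<le> 4")
    case True then show ?thesis using half[of v] l_cases by auto
  next
    case False
    then have l5: "l \<ge> 4" "l \<ge> 5" by auto
    have "v \<noteq> y" using yB[of u] nc(1)[OF u, of u] uv u l5 x by auto
    moreover have "v \<notin> B" using nc(2)[OF u _ l5(2)] uv by auto
    ultimately show ?thesis
      using uv u l_cases False by (auto simp: f_def mid_def)
  qed
  have below_B: "f u \<ge> r - 1" if uv: "{u, v} \<in> E" and v: "v \<in> B" for u v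
  proof (cases "l \<le> 4")
    case True then show ?thesis using half[of u] l_cases by auto
  next
    case False
    then have l5: "l \<ge> 4" "l \<ge> 5" by auto
    have vu: "{v, u} \<in> E" using uv by (simp add: insert_commute)
    have "u \<noteq> x" using xA[of v] nc(1)[of v, OF _ v] uv v l5 x by auto
    moreover have "u \<notin> A" using nc(2)[OF _ v l5(2)] uv by auto
    moreover have "\<not> (\<exists>a\<in>A. {a, u} \<in> E)" if "l = 6" "u \<noteq> x" "u \<noteq> y"
      using nc(3)[OF _ v _ _ vu] that by auto
    ultimately show ?thesis
      using vu v l_cases False by (auto simp: f_def mid_def)
  qed
  show ?thesis
  proof (rule that[of f])
    show "f x = -1/2" "f y = 1/2" using x by (simp_all add: f_def)
    show fA: "f z = - (real l - 3) / 2" if "z \<in> neighbors E x - {y}" for z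
      using that x by (auto simp: A_def f_def r_def field_simps)
    show fB: "f z = (real l - 3) / 2" if "z \<in> neighbors E y - {x}" for z
    proof -
      have "z \<in> B" using that by (simp add: B_def)
      then have "z \<notin> A \<or> r = 0" using nc(1)[of z z] l_cases by auto
      with \<open>z \<in> B\<close> x show ?thesis by (auto simp: f_def r_def)
    qed
    show "f v - f u \<le> 1" if uv: "{u, v} \<in> E" for u v
    proof -
      consider "u \<in> A" | "v \<in> B" | "u \<notin> A" "v \<notin> B" by blast
      then show ?thesis
      proof cases
        case 1
        then have "f u = - r" using fA[of u] by (simp add: A_def r_def field_simps)
        then show ?thesis using above_A[OF uv 1] by simp
      next
        case 2
        then have "f v = r" using fB[of v] by (simp add: B_def r_def)
        then show ?thesis using below_B[OF uv 2] by simp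
      next
        case 3
        moreover have "r \<ge> 0" using l_cases by auto
        ultimately have "f u \<ge> -1/2" "f v \<le> 1/2"
          using mid[of u] mid[of v] by (auto simp: f_def)
        then show ?thesis by simp
      qed
    qed
  qed
qed

lemma set_lazy_measure:
  assumes "finite_simple_graph V E" "positive_weight E w" "0 \<le> \<alpha>" "\<alpha> \<le> 1" "{x, y} \<in> E"
  shows "set_pmf (lazy_measure E w \<alpha> x) \<subseteq> insert x (neighbors E x)"
proof
  fix z assume "z \<in> set_pmf (lazy_measure E w \<alpha> x)"
  moreover have "neighbors E x \<noteq> {}" using assms by (auto simp: neighbors_def)
  ultimately have "lazy_mass E w \<alpha> x z \<noteq> 0"
    using pmf_lazy_measure[OF assms(1-4)] by (simp add: set_pmf_iff)
  then show "z \<in> insert x (neighbors E x)" by (auto simp: lazy_mass_def split: if_splits)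
qed

lemma finite_set_lazy_measure:
  assumes "finite_simple_graph V E" "positive_weight E w" "0 \<le> \<alpha>" "\<alpha> \<le> 1" "{x, y} \<in> E"
  shows "finite (set_pmf (lazy_measure E w \<alpha> x))"
  using finite_subset[OF set_lazy_measure[OF assms]] finite_neighbors[OF assms(1)] by blast

lemma expectation_lazy_measure:
  fixes f :: "'a \<Rightarrow> real"
  assumes G: "finite_simple_graph V E" and w: "positive_weight E w" and \<alpha>: "0 \<le> \<alpha>" "\<alpha> \<le> 1"
    and xy: "{x, y} \<in> E" and f: "\<And>z. z \<in> neighbors E x - {y} \<Longrightarrow> f z = a"
  shows "measure_pmf.expectation (lazy_measure E w \<alpha> x) f
    = \<alpha> * f x + (1 - \<alpha>) * (w {x, y} / weighted_degree E w x * f y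
        + (1 - w {x, y} / weighted_degree E w x) * a)"
proof -
  let ?N = "neighbors E x" and ?d = "weighted_degree E w x"
  have fin: "finite ?N" using G by (rule finite_neighbors)
  have y: "y \<in> ?N" and x: "x \<notin> ?N"
    using xy graph_edge_props(3)[OF G, of x x] by (auto simp: neighbors_def)
  have d: "?d > 0" using G w xy by (rule weighted_degree_pos) simp
  have "?d = w {x, y} + (\<Sum>z\<in>?N - {y}. w {x, z})"
    unfolding weighted_degree_def using fin y by (rule sum.remove)
  then have rest: "(\<Sum>z\<in>?N - {y}. w {x, z}) / ?d = 1 - w {x, y} / ?d"
    using d by (simp add: field_simps)
  have "measure_pmf.expectation (lazy_measure E w \<alpha> x) f
      = (\<Sum>z\<in>insert x ?N. pmf (lazy_measure E w \<alpha> x) z * f z)"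
    using fin set_lazy_measure[OF G w \<alpha> xy] by (subst integral_measure_pmf[of "insert x ?N"]) auto
  also have "\<dots> = \<alpha> * f x + (\<Sum>z\<in>?N. (1 - \<alpha>) * (w {x, z} / ?d * f z))"
  proof -
    have "pmf (lazy_measure E w \<alpha> x) z = lazy_mass E w \<alpha> x z" for z
      using y by (intro pmf_lazy_measure[OF G w \<alpha>]) auto
    moreover have "(\<Sum>z\<in>?N. lazy_mass E w \<alpha> x z * f z) = (\<Sum>z\<in>?N. (1 - \<alpha>) * (w {x, z} / ?d * f z))"
      using x by (intro sum.cong) (auto simp: lazy_mass_def)
    moreover have "lazy_mass E w \<alpha> x x = \<alpha>" by (simp add: lazy_mass_def)
    ultimately show ?thesis using fin x by simp
  qed
  also have "(\<Sum>z\<in>?N. (1 - \<alpha>) * (w {x, z} / ?d * f z))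
      = (1 - \<alpha>) * (w {x, y} / ?d * f y + (\<Sum>z\<in>?N - {y}. w {x, z} / ?d * a))"
    unfolding sum_distrib_left[symmetric] using fin y f by (simp add: sum.remove[of ?N y])
  also have "(\<Sum>z\<in>?N - {y}. w {x, z} / ?d * a) = (\<Sum>z\<in>?N - {y}. w {x, z}) / ?d * a"
    by (simp only: sum_divide_distrib sum_distrib_right)
  finally show ?thesis unfolding rest .
qed

text \<open>
  A lazier walk decides first, with probability \<open>(1 - \<beta>) / (1 - \<alpha>)\<close>, whether to perform
  a step of the less lazy one at all.
\<close>

lemma lazy_measure_mixture:
  assumes G: "finite_simple_graph V E" and w: "positive_weight E w"
    and \<alpha>: "0 \<le> \<alpha>" "\<alpha> \<le> \<beta>" "\<beta> < 1" and xy: "{x, y} \<in> E"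
  shows "lazy_measure E w \<beta> x = bind_pmf (bernoulli_pmf ((1 - \<beta>) / (1 - \<alpha>)))
    (\<lambda>b. if b then lazy_measure E w \<alpha> x else return_pmf x)"
proof -
  define r where "r = (1 - \<beta>) / (1 - \<alpha>)"
  have N: "neighbors E x \<noteq> {}" using xy by (auto simp: neighbors_def)
  have r: "0 \<le> r" "r \<le> 1" and r1: "r * (1 - \<alpha>) = 1 - \<beta>" using \<alpha> by (auto simp: r_def)
  show ?thesis
    unfolding r_def[symmetric]
  proof (rule pmf_eqI)
    fix z
    have "pmf (bind_pmf (bernoulli_pmf r)
        (\<lambda>b. if b then lazy_measure E w \<alpha> x else return_pmf x)) z
        = r * lazy_mass E w \<alpha> x z + (1 - r) * (if z = x then 1 else 0)"
      using r \<alpha> pmf_lazy_measure[OF G w _ _ N, of \<alpha>] by (simp add: pmf_bind indicator_def)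
    also have "\<dots> = lazy_mass E w \<beta> x z"
    proof (cases "z = x")
      case True
      then show ?thesis using r1 by (simp add: lazy_mass_def algebra_simps)
    next
      case False
      then show ?thesis unfolding lazy_mass_def r1[symmetric] by simp
    qed
    finally show "pmf (lazy_measure E w \<beta> x) z = pmf (bind_pmf (bernoulli_pmf r)
        (\<lambda>b. if b then lazy_measure E w \<alpha> x else return_pmf x)) z"
      using pmf_lazy_measure[OF G w _ _ N, of \<beta>] \<alpha> by simp
  qed
qed

lemma graph_dist_edge_le:
  assumes "finite_simple_graph V E" "{x, y} \<in> E"
  shows "graph_dist V E x y \<le> 1"
  using graph_edge_props[OF assms] assms(2)
  by (intro graph_dist_le[of V E "[x, y]"]) (auto simp: is_walk_Cons is_walk_singleton)

text \<open>
  By convexity the cost for \<open>\<beta>\<close> is at most the mixture of the cost for \<open>\<alpha>\<close> and of \<open>d x y = 1\<close>, so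
  \<open>kappa_alpha\<close> at \<open>\<beta>\<close> is at least \<open>(1 - \<beta>) / (1 - \<alpha>)\<close> times its value at \<open>\<alpha>\<close>.
\<close>

lemma kappa_quotient_mono:
  assumes G: "finite_simple_graph V E" and w: "positive_weight E w" and xy: "{x, y} \<in> E"
    and \<alpha>: "0 \<le> \<alpha>" "\<alpha> \<le> \<beta>" "\<beta> < 1"
  shows "kappa_alpha V E w \<alpha> x y / (1 - \<alpha>) \<le> kappa_alpha V E w \<beta> x y / (1 - \<beta>)"
proof -
  let ?d = "\<lambda>u v. real (graph_dist V E u v)"
  let ?W = "\<lambda>\<alpha>. wasserstein1 ?d (lazy_measure E w \<alpha> x) (lazy_measure E w \<alpha> y)"
  define r where "r = (1 - \<beta>) / (1 - \<alpha>)"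
  have r: "0 < r" "r \<le> 1" "1 - \<beta> = r * (1 - \<alpha>)" using \<alpha> by (auto simp: r_def)
  have yx: "{y, x} \<in> E" using xy by (simp add: insert_commute)
  have "?W \<beta> \<le> r * ?W \<alpha> + (1 - r) * ?d x y"
    unfolding lazy_measure_mixture[OF G w \<alpha> xy] lazy_measure_mixture[OF G w \<alpha> yx] r_def[symmetric]
    using \<alpha> r(1,2) by (intro wasserstein1_mixture_le finite_set_lazy_measure[OF G w _ _ xy]
      finite_set_lazy_measure[OF G w _ _ yx]) auto
  also have "\<dots> \<le> r * ?W \<alpha> + (1 - r) * 1"
    using graph_dist_edge_le[OF G xy] r by (intro add_left_mono mult_left_mono) auto
  finally have "r * kappa_alpha V E w \<alpha> x y \<le> kappa_alpha V E w \<beta> x y"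
    by (simp add: kappa_alpha_def algebra_simps)
  then have "r * kappa_alpha V E w \<alpha> x y / (r * (1 - \<alpha>)) \<le> kappa_alpha V E w \<beta> x y / (1 - \<beta>)"
    unfolding r(3) using r \<alpha> by (intro divide_right_mono) auto
  then show ?thesis using r by simp
qed

text \<open>
  Put \<open>r = (l - 3) / 2\<close>. Between the two lazy measures the mean of the separating function
  increases by \<open>\<alpha> + (1 - \<alpha>) * (2 * r - (r + 1/2) * s)\<close>, where \<open>s\<close> is the share of the edge.
\<close>

lemma kappa_quotient_le:
  assumes G: "finite_simple_graph V E" and conn: "connected_graph V E"
    and l: "l \<in> {3, 4, 5, 6}" and g: "girth V E \<ge> enat l"
    and w: "positive_weight E w" and xy: "{x, y} \<in> E" and \<alpha>: "0 \<le> \<alpha>" "\<alpha> < 1"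
  shows "kappa_alpha V E w \<alpha> x y / (1 - \<alpha>) \<le> 4 - real l + (real l - 2) / 2 * edge_share E w {x, y}"
proof -
  let ?\<mu> = "lazy_measure E w \<alpha> x" and ?\<nu> = "lazy_measure E w \<alpha> y"
  let ?P = "w {x, y} / weighted_degree E w x" and ?Q = "w {y, x} / weighted_degree E w y"
  have yx: "{y, x} \<in> E" using xy by (simp add: insert_commute)
  have \<alpha>1: "\<alpha> \<le> 1" using \<alpha> by simp
  obtain f where lip: "\<And>u v. {u, v} \<in> E \<Longrightarrow> f v - f u \<le> 1"
    and fxy: "f x = -1/2" "f y = 1/2"
    and fA: "\<And>z. z \<in> neighbors E x - {y} \<Longrightarrow> f z = - (real l - 3) / 2"
    and fB: "\<And>z. z \<in> neighbors E y - {x} \<Longrightarrow> f z = (real l - 3) / 2"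
    using separating_function_exists[OF G l g xy] by blast
  have inV: "insert u (neighbors E u) \<subseteq> V" if "{u, v} \<in> E" for u v
    using graph_edge_props(1,2)[OF G] that by (auto simp: neighbors_def)
  have "measure_pmf.expectation ?\<nu> f - measure_pmf.expectation ?\<mu> f
      \<le> wasserstein1 (\<lambda>u v. real (graph_dist V E u v)) ?\<mu> ?\<nu>"
  proof (intro wasserstein1_ge increment_le_graph_dist lip conn)
    show "finite (set_pmf ?\<mu>)" "finite (set_pmf ?\<nu>)"
      using finite_set_lazy_measure[OF G w \<alpha>(1) \<alpha>1] xy yx by blast+
  qed (use inV[OF xy] inV[OF yx] set_lazy_measure[OF G w \<alpha>(1) \<alpha>1 xy]
    set_lazy_measure[OF G w \<alpha>(1) \<alpha>1 yx] in auto)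
  moreover have "measure_pmf.expectation ?\<mu> f
      = \<alpha> * (-1/2) + (1 - \<alpha>) * (?P * (1/2) + (1 - ?P) * (- (real l - 3) / 2))"
    using expectation_lazy_measure[where f = f, OF G w \<alpha>(1) \<alpha>1 xy fA] unfolding fxy .
  moreover have "measure_pmf.expectation ?\<nu> f
      = \<alpha> * (1/2) + (1 - \<alpha>) * (?Q * (-1/2) + (1 - ?Q) * ((real l - 3) / 2))"
    using expectation_lazy_measure[where f = f, OF G w \<alpha>(1) \<alpha>1 yx fB] unfolding fxy .
  ultimately have "kappa_alpha V E w \<alpha> x y
      \<le> 1 - ((\<alpha> * (1/2) + (1 - \<alpha>) * (?Q * (-1/2) + (1 - ?Q) * ((real l - 3) / 2)))
        - (\<alpha> * (-1/2) + (1 - \<alpha>) * (?P * (1/2) + (1 - ?P) * (- (real l - 3) / 2))))"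
    unfolding kappa_alpha_def by linarith
  also have "\<dots> = (4 - real l + (real l - 2) / 2 * (?P + ?Q)) * (1 - \<alpha>)"
  proof -
    have "1 - ((\<alpha> * (1/2) + (1 - \<alpha>) * (Q * (-1/2) + (1 - Q) * ((real l - 3) / 2)))
        - (\<alpha> * (-1/2) + (1 - \<alpha>) * (P * (1/2) + (1 - P) * (- (real l - 3) / 2))))
      = (4 - real l + (real l - 2) / 2 * (P + Q)) * (1 - \<alpha>)" for P Q :: real
      by (simp add: field_simps)
    then show ?thesis .
  qed
  finally show ?thesis
    unfolding edge_share_edge[OF graph_edge_props(3)[OF G xy]] using \<alpha> by (simp only: pos_divide_le_eq)
qed

text \<open>
  The quotients increase with \<open>\<alpha>\<close>, and the bound for \<open>l = 3\<close> applies to every graph.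
\<close>

lemma kappa_LLY_tendsto:
  assumes G: "finite_simple_graph V E" and conn: "connected_graph V E"
    and w: "positive_weight E w" and xy: "{x, y} \<in> E"
  shows "((\<lambda>\<alpha>. kappa_alpha V E w \<alpha> x y / (1 - \<alpha>)) \<longlongrightarrow> kappa_LLY V E w x y) (at_left 1)"
proof -
  let ?q = "\<lambda>\<alpha>. kappa_alpha V E w \<alpha> x y / (1 - \<alpha>)"
  let ?L = "Sup (?q ` {0..<1})"
  have bdd: "bdd_above (?q ` {0..<1})"
    using kappa_quotient_le[OF G conn _ girth_ge_3 w xy] by (intro bdd_aboveI2) auto
  have "(?q \<longlongrightarrow> ?L) (at_left 1)"
  proof (rule increasing_tendsto)
    have "\<forall>\<^sub>F \<alpha> in at_left (1::real). \<alpha> \<in> {0<..<1}" by (rule eventually_at_left_real) simp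
    then show "\<forall>\<^sub>F \<alpha> in at_left 1. ?q \<alpha> \<le> ?L"
      by eventually_elim (intro cSUP_upper bdd, simp)
    fix s assume "s < ?L"
    then obtain \<beta> where \<beta>: "0 \<le> \<beta>" "\<beta> < 1" "s < ?q \<beta>"
      using less_cSup_iff[of "?q ` {0..<1}" s] bdd by auto
    have "\<forall>\<^sub>F \<alpha> in at_left (1::real). \<alpha> \<in> {\<beta><..<1}" using \<beta>(2) by (rule eventually_at_left_real)
    then show "\<forall>\<^sub>F \<alpha> in at_left 1. s < ?q \<alpha>"
    proof eventually_elim
      case (elim \<alpha>)
      then have "?q \<beta> \<le> ?q \<alpha>" using \<beta> by (intro kappa_quotient_mono[OF G w xy]) auto
      with \<beta>(3) show ?case by simp
    qed
  qed
  moreover from this have "kappa_LLY V E w x y = ?L"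
    unfolding kappa_LLY_def by (intro tendsto_Lim) simp_all
  ultimately show ?thesis by simp
qed

lemma kappa_LLY_le:
  assumes G: "finite_simple_graph V E" and conn: "connected_graph V E"
    and l: "l \<in> {3, 4, 5, 6}" and g: "girth V E \<ge> enat l"
    and w: "positive_weight E w" and xy: "{x, y} \<in> E"
  shows "kappa_LLY V E w x y \<le> 4 - real l + (real l - 2) / 2 * edge_share E w {x, y}"
proof (rule tendsto_upperbound[OF kappa_LLY_tendsto[OF G conn w xy]])
  have "\<forall>\<^sub>F \<alpha> in at_left (1::real). \<alpha> \<in> {0<..<1}" by (rule eventually_at_left_real) simp
  then show "\<forall>\<^sub>F \<alpha> in at_left 1. kappa_alpha V E w \<alpha> x y / (1 - \<alpha>)
      \<le> 4 - real l + (real l - 2) / 2 * edge_share E w {x, y}"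
    by eventually_elim (intro kappa_quotient_le[OF G conn l g w xy], auto)
qed simp

text \<open>
  Routing along \<open>u, x, y, v\<close> costs the difference of the positions \<open>0, 1, 2, 3\<close> on this path. Only
  the pair \<open>(y, x)\<close>, which is traversed backwards, has a difference \<open>-1\<close> instead of the distance \<open>1\<close>.
\<close>

lemma graph_dist_across_edge_le:
  assumes G: "finite_simple_graph V E" and xy: "{x, y} \<in> E"
    and u: "u \<in> insert x (neighbors E x)" and v: "v \<in> insert y (neighbors E y)"
  shows "real (graph_dist V E u v) \<le> (if v = x then 1 else if v = y then 2 else 3)
    - (if u = x then 1 else if u = y then 2 else 0) + 2 * (if (u, v) = (y, x) then 1 else 0)"
proof -
  note ed = graph_edge_props[OF G]
  have yx: "{y, x} \<in> E" using xy by (simp add: insert_commute)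
  have E: "u \<noteq> x \<Longrightarrow> {u, x} \<in> E" "v \<noteq> y \<Longrightarrow> {y, v} \<in> E"
    using u v by (auto simp: neighbors_def insert_commute)
  note V = ed[OF xy] ed[OF E(1)] ed[OF E(2)]
  note w = is_walk_Cons is_walk_singleton
  consider "u = x" "v = x" | "u = x" "v = y" | "u = x" "v \<noteq> x" "v \<noteq> y"
    | "u = y" "v = x" | "u = y" "v = y" | "u = y" "v \<noteq> x" "v \<noteq> y"
    | "u \<noteq> x" "u \<noteq> y" "v = x" | "u \<noteq> x" "u \<noteq> y" "v = y" | "u \<noteq> x" "u \<noteq> y" "v \<noteq> x" "v \<noteq> y"
    by blast
  then show ?thesis
  proof cases
    case 1
    have "graph_dist V E u v \<le> 0"
      by (rule graph_dist_le[of V E "[x]"]) (use 1 V in \<open>auto simp: w\<close>)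
    with 1 show ?thesis by simp
  next
    case 2
    have "graph_dist V E u v \<le> 1"
      by (rule graph_dist_le[of V E "[x, y]"]) (use 2 V xy in \<open>auto simp: w\<close>)
    with 2 V show ?thesis by simp
  next
    case 3
    have "graph_dist V E u v \<le> 2"
      by (rule graph_dist_le[of V E "[x, y, v]"]) (use 3 V xy E in \<open>auto simp: w\<close>)
    with 3 show ?thesis by simp
  next
    case 4
    have "graph_dist V E u v \<le> 1"
      by (rule graph_dist_le[of V E "[y, x]"]) (use 4 V yx in \<open>auto simp: w\<close>)
    with 4 V show ?thesis by simp
  next
    case 5
    have "graph_dist V E u v \<le> 0"
      by (rule graph_dist_le[of V E "[y]"]) (use 5 V in \<open>auto simp: w\<close>)
    with 5 V show ?thesis by simp
  next
    case 6
    have "graph_dist V E u v \<le> 1"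
      by (rule graph_dist_le[of V E "[y, v]"]) (use 6 V E in \<open>auto simp: w\<close>)
    with 6 V show ?thesis by simp
  next
    case 7
    have "graph_dist V E u v \<le> 1"
      by (rule graph_dist_le[of V E "[u, x]"]) (use 7 V E in \<open>auto simp: w\<close>)
    with 7 show ?thesis by simp
  next
    case 8
    have "graph_dist V E u v \<le> 2"
      by (rule graph_dist_le[of V E "[u, x, y]"]) (use 8 V E xy in \<open>auto simp: w\<close>)
    with 8 V show ?thesis by simp
  next
    case 9
    have "graph_dist V E u v \<le> 3"
      by (rule graph_dist_le[of V E "[u, x, y, v]"]) (use 9 V E xy in \<open>auto simp: w\<close>)
    with 9 show ?thesis by simp
  qed
qed

text \<open>
  In the independent coupling only the pair \<open>(y, x)\<close> moves backwards along the path through \<open>xy\<close>; its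
  mass is of second order in \<open>1 - \<alpha>\<close>, so the limit does not see it.
\<close>

lemma kappa_LLY_ge:
  assumes G: "finite_simple_graph V E" and conn: "connected_graph V E"
    and w: "positive_weight E w" and xy: "{x, y} \<in> E"
  shows "kappa_LLY V E w x y \<ge> 2 * edge_share E w {x, y} - 2"
proof -
  let ?P = "w {x, y} / weighted_degree E w x" and ?Q = "w {y, x} / weighted_degree E w y"
  let ?h = "\<lambda>u. if u = x then 1 else if u = y then 2 else 0 :: real"
  let ?g = "\<lambda>v. if v = x then 1 else if v = y then 2 else 3 :: real"
  have yx: "{y, x} \<in> E" using xy by (simp add: insert_commute)
  have ne: "x \<noteq> y" using G xy by (rule graph_edge_props)
  have "2 * (?P + ?Q) - 2 - 2 * ?P * ?Q * (1 - \<alpha>) \<le> kappa_alpha V E w \<alpha> x y / (1 - \<alpha>)"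
    if \<alpha>: "0 < \<alpha>" "\<alpha> < 1" for \<alpha>
  proof -
    let ?\<mu> = "lazy_measure E w \<alpha> x" and ?\<nu> = "lazy_measure E w \<alpha> y"
    have \<alpha>': "0 \<le> \<alpha>" "\<alpha> \<le> 1" using \<alpha> by auto
    note supp = set_lazy_measure[OF G w \<alpha>' xy] set_lazy_measure[OF G w \<alpha>' yx]
    have "wasserstein1 (\<lambda>u v. real (graph_dist V E u v)) ?\<mu> ?\<nu>
        \<le> measure_pmf.expectation ?\<nu> ?g - measure_pmf.expectation ?\<mu> ?h
          + 2 * (pmf ?\<mu> (fst (y, x)) * pmf ?\<nu> (snd (y, x)))"
      using finite_set_lazy_measure[OF G w \<alpha>' xy] finite_set_lazy_measure[OF G w \<alpha>' yx]
      by (intro wasserstein1_le_product graph_dist_across_edge_le[OF G xy]) (use supp in auto)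
    also have "pmf ?\<mu> (fst (y, x)) = (1 - \<alpha>) * ?P"
      using pmf_lazy_measure[OF G w \<alpha>', of x y] xy ne by (auto simp: lazy_mass_def neighbors_def)
    also have "pmf ?\<nu> (snd (y, x)) = (1 - \<alpha>) * ?Q"
      using pmf_lazy_measure[OF G w \<alpha>', of y x] yx ne by (auto simp: lazy_mass_def neighbors_def)
    also have "measure_pmf.expectation ?\<mu> ?h = \<alpha> + (1 - \<alpha>) * (?P * 2)"
      using graph_edge_props(3)[OF G, of x x] ne
      by (subst expectation_lazy_measure[OF G w \<alpha>' xy, where a = 0]) (auto simp: neighbors_def)
    also have "measure_pmf.expectation ?\<nu> ?g = \<alpha> * 2 + (1 - \<alpha>) * (?Q + (1 - ?Q) * 3)"
      using graph_edge_props(3)[OF G, of y y] ne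
      by (subst expectation_lazy_measure[OF G w \<alpha>' yx, where a = 3]) (auto simp: neighbors_def)
    finally have "1 - (\<alpha> * 2 + (1 - \<alpha>) * (?Q + (1 - ?Q) * 3) - (\<alpha> + (1 - \<alpha>) * (?P * 2))
        + 2 * ((1 - \<alpha>) * ?P * ((1 - \<alpha>) * ?Q))) \<le> kappa_alpha V E w \<alpha> x y"
      unfolding kappa_alpha_def by linarith
    also have "1 - (\<alpha> * 2 + (1 - \<alpha>) * (?Q + (1 - ?Q) * 3) - (\<alpha> + (1 - \<alpha>) * (?P * 2))
        + 2 * ((1 - \<alpha>) * ?P * ((1 - \<alpha>) * ?Q)))
        = (2 * (?P + ?Q) - 2 - 2 * ?P * ?Q * (1 - \<alpha>)) * (1 - \<alpha>)"
      by algebra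
    finally show ?thesis using \<alpha> by (simp only: pos_le_divide_eq)
  qed
  moreover have "\<forall>\<^sub>F \<alpha> in at_left (1::real). \<alpha> \<in> {0<..<1}" by (rule eventually_at_left_real) simp
  ultimately have ev: "\<forall>\<^sub>F \<alpha> in at_left 1. 2 * (?P + ?Q) - 2 - 2 * ?P * ?Q * (1 - \<alpha>)
      \<le> kappa_alpha V E w \<alpha> x y / (1 - \<alpha>)"
    by (auto elim: eventually_mono)
  have "((\<lambda>\<alpha>. 2 * (?P + ?Q) - 2 - 2 * ?P * ?Q * (1 - \<alpha>))
      \<longlongrightarrow> 2 * (?P + ?Q) - 2 - 2 * ?P * ?Q * (1 - 1)) (at_left 1)"
    by (intro tendsto_intros)
  from tendsto_le[OF _ kappa_LLY_tendsto[OF G conn w xy] this ev] show ?thesis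
    by (simp add: edge_share_edge[OF ne])
qed

section \<open>Curvature of the graph\<close>

lemma finite_edge_curvatures:
  assumes "finite_simple_graph V E"
  shows "finite {kappa_LLY V E w x y | x y. {x, y} \<in> E}"
proof (rule finite_subset)
  show "{kappa_LLY V E w x y | x y. {x, y} \<in> E} \<subseteq> (\<lambda>(x, y). kappa_LLY V E w x y) ` (V \<times> V)"
    using graph_edge_props(1,2)[OF assms] by force
  show "finite ((\<lambda>(x, y). kappa_LLY V E w x y) ` (V \<times> V))"
    using finite_graph_edges(1)[OF assms] by simp
qed

text \<open>
  The minimum curvature is at most the average of the edge bounds over the edges of a densest
  subgraph.
\<close>

lemma kappa_LLY_graph_le:
  assumes G: "finite_simple_graph V E" and conn: "connected_graph V E" and ne: "E \<noteq> {}"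
    and l: "l \<in> {3, 4, 5, 6}" and g: "girth V E \<ge> enat l" and w: "positive_weight E w"
  shows "kappa_LLY_graph V E w \<le> 4 - real l + (real l - 2) / mad V E"
proof -
  let ?k = "kappa_LLY_graph V E w" and ?c = "(real l - 2) / 2"
  obtain W F where H: "subgraph_of W F V E" "W \<noteq> {}" "F \<noteq> {}"
    and mad: "mad V E = 2 * real (card F) / real (card W)"
    using mad_attained[OF G ne] by blast
  have "finite F" "finite W" "F \<subseteq> E"
    using H(1) finite_graph_edges[OF G] finite_subset by (auto simp: subgraph_of_def)
  then have pos: "card F > 0" "card W > 0" using H by auto
  have "?k \<le> 4 - real l + ?c * edge_share E w e" if "e \<in> F" for e
  proof -
    have e: "e \<in> E" using that \<open>F \<subseteq> E\<close> by auto
    with G obtain x y where xy: "e = {x, y}" by (rule graph_edge_cases)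
    have "?k \<le> kappa_LLY V E w x y"
      unfolding kappa_LLY_graph_def using e xy by (intro Min_le finite_edge_curvatures[OF G]) auto
    also have "\<dots> \<le> 4 - real l + ?c * edge_share E w e"
      using kappa_LLY_le[OF G conn l g w] e xy by simp
    finally show ?thesis .
  qed
  then have "(\<Sum>e\<in>F. ?k) \<le> (\<Sum>e\<in>F. 4 - real l + ?c * edge_share E w e)"
    by (rule sum_mono)
  also have "\<dots> = (4 - real l) * real (card F) + ?c * (\<Sum>e\<in>F. edge_share E w e)"
    by (simp add: sum.distrib sum_distrib_left)
  also have "\<dots> \<le> (4 - real l) * real (card F) + ?c * real (card W)"
    using l sum_edge_share_le_card[OF G w H(1)] by (intro add_left_mono mult_left_mono) auto
  finally have "?k * real (card F) \<le> (4 - real l) * real (card F) + ?c * real (card W)"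
    by (simp add: mult.commute)
  then have "?k \<le> ((4 - real l) * real (card F) + ?c * real (card W)) / real (card F)"
    using pos by (simp add: pos_le_divide_eq)
  also have "\<dots> = 4 - real l + (real l - 2) / mad V E"
    unfolding mad using pos by (simp add: field_simps)
  finally show ?thesis .
qed

lemma bdd_above_kappa_LLY_graph:
  assumes "finite_simple_graph V E" "connected_graph V E" "E \<noteq> {}"
  shows "bdd_above (kappa_LLY_graph V E ` {w. positive_weight E w})"
  using kappa_LLY_graph_le[OF assms _ girth_ge_3] by (intro bdd_aboveI2) auto

text \<open>
  The value \<open>t = 2 / mad V E\<close> is approached from below, because positive weights with shares at
  least \<open>2 / mad V E\<close> need not exist: the objective then may lose its coercivity.
\<close>

lemma kappa_LLY_max_ge:
  assumes G: "finite_simple_graph V E" and conn: "connected_graph V E" and ne: "E \<noteq> {}"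
  shows "4 / mad V E - 2 \<le> kappa_LLY_max V E"
proof -
  have mad: "mad V E > 0" using G ne by (rule mad_pos)
  have below: "2 * t - 2 \<le> kappa_LLY_max V E" if t: "0 < t" "t < 2 / mad V E" for t
  proof -
    have "t * mad V E < 2" using t mad by (simp add: pos_less_divide_eq)
    with G t(1) obtain w where w: "positive_weight E w"
      and share: "\<And>e. e \<in> E \<Longrightarrow> t \<le> edge_share E w e"
      by (rule weight_with_large_shares) blast
    have "2 * t - 2 \<le> kappa_LLY_graph V E w"
      unfolding kappa_LLY_graph_def
    proof (rule Min.boundedI)
      obtain e where "e \<in> E" using ne by blast
      moreover from G this obtain x y where "e = {x, y}" by (rule graph_edge_cases)
      ultimately show "{kappa_LLY V E w x y | x y. {x, y} \<in> E} \<noteq> {}" by blast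
      fix k assume "k \<in> {kappa_LLY V E w x y | x y. {x, y} \<in> E}"
      then obtain u v where "k = kappa_LLY V E w u v" "{u, v} \<in> E" by blast
      then show "2 * t - 2 \<le> k"
        using kappa_LLY_ge[OF G conn w, of u v] share[of "{u, v}"] by simp
    qed (rule finite_edge_curvatures[OF G])
    also have "\<dots> \<le> kappa_LLY_max V E"
      unfolding kappa_LLY_max_def using w
      by (intro cSUP_upper bdd_above_kappa_LLY_graph[OF G conn ne]) simp
    finally show ?thesis .
  qed
  have "2 / mad V E \<le> (kappa_LLY_max V E + 2) / 2"
  proof (rule dense_le_bounded[of 0])
    show "0 < 2 / mad V E" using mad by simp
    show "t \<le> (kappa_LLY_max V E + 2) / 2" if "0 < t" "t < 2 / mad V E" for t
      using below[OF that] by simp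
  qed
  then show ?thesis by simp
qed

theorem theorem1p3:
  fixes V :: "'a set" and E :: "'a set set" and l :: nat
  assumes "finite_simple_graph V E"
    and "connected_graph V E"
    and "E \<noteq> {}"
    and "l \<in> {3, 4, 5, 6}"
    and "girth V E \<ge> enat l"
  shows "kappa_LLY_max V E \<le> 4 - real l + (real l - 2) / mad V E
    \<and> (l = 6 \<longrightarrow> kappa_LLY_max V E = 4 - real l + (real l - 2) / mad V E)"
proof -
  have "positive_weight E (\<lambda>e. 1)" by (simp add: positive_weight_def)
  then have "kappa_LLY_max V E \<le> 4 - real l + (real l - 2) / mad V E"
    unfolding kappa_LLY_max_def
    by (intro cSUP_least) (auto intro: kappa_LLY_graph_le[OF assms])
  with kappa_LLY_max_ge[OF assms(1-3)] show ?thesis by auto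
qed

end
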